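(* Let $d\ge2$ and $\zeta_d=\log\frac{\mu_d}{\mu_{d-1}}$ (with $\mu_1=1$). For $\rho\in(0,1)$ let $\nu_n(\rho)$ be the number of zeros (with multiplicity) of $A_n^+(a)$ in the annulus $1-\rho\le|a|\le\frac1{1-\rho}$ of the complex $a$-plane. If $\zeta_d<\rho<1$, then \[ 0<1-\frac1\rho\zeta_d\le\liminf_{n\to\infty}\frac1n\nu_n(\rho)\le\limsup_{n\to\infty}\frac1n\nu_n(\rho)\le1, \] and a positive fraction of the partition function zeros of $A_n^+(a)$ are in the annulus $1-\rho<|a|<\frac1{1-\rho}$.
   Context: Let $\mathbb{L}^d$ be the $d$-dimensional hypercubic lattice and $\mathbb{L}^d_+$ the half-lattice of vertices with last coordinate $\ge0$. A positive walk is a self-avoiding walk in $\mathbb{L}^d_+$ starting at the origin; its visits are its vertices other than the origin with last coordinate $0$. $c_n^+(v)$ is the number of positive walks of length $n$ with $v$ visits and $A_n^+(a)=\sum_{v=0}^n c_n^+(v)a^v$. $\mu_d$ and $\mu_{d-1}$ are the growth constants of self-avoiding walks in the $d$- and $(d-1)$-dimensional hypercubic lattices, with the convention $\mu_1=1$. *)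

theory Defs
  imports "HOL-Analysis.Analysis" "HOL-Computational_Algebra.Polynomial"
begin

text \<open>Vertices of the hypercubic lattice L^d are functions nat => int vanishing
  outside the coordinates 0..d-1; coordinate d-1 is the last coordinate.\<close>

type_synonym vertex = "nat \<Rightarrow> int"

definition origin :: vertex where "origin = (\<lambda>_. 0)"

definition lattice_vertex :: "nat \<Rightarrow> vertex \<Rightarrow> bool" where
  "lattice_vertex d x \<longleftrightarrow> (\<forall>i\<ge>d. x i = 0)"

definition adj :: "nat \<Rightarrow> vertex \<Rightarrow> vertex \<Rightarrow> bool" where
  "adj d x y \<longleftrightarrow> lattice_vertex d x \<and> lattice_vertex d y \<and> (\<Sum>i<d. \<bar>x i - y i\<bar>) = 1"

definition saw :: "nat \<Rightarrow> nat \<Rightarrow> vertex list set" where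
  "saw d n = {w. length w = Suc n \<and> w ! 0 = origin \<and> distinct w \<and>
                 (\<forall>i<n. adj d (w ! i) (w ! Suc i))}"

text \<open>Growth constant: mu_d = lim c_n^(1/n). (For d = 1, c_n = 2 for n >= 1,
  so this limit is 1, agreeing with the convention mu_1 = 1.)\<close>
definition mu :: "nat \<Rightarrow> real" where
  "mu d = lim (\<lambda>n. real (card (saw d n)) powr (1 / real n))"

definition pos_walks :: "nat \<Rightarrow> nat \<Rightarrow> vertex list set" where
  "pos_walks d n = {w \<in> saw d n. \<forall>x\<in>set w. x (d - 1) \<ge> 0}"

definition visits :: "nat \<Rightarrow> vertex list \<Rightarrow> nat" where
  "visits d w = card {i. 1 \<le> i \<and> i < length w \<and> (w ! i) (d - 1) = 0}"

definition c_plus :: "nat \<Rightarrow> nat \<Rightarrow> nat \<Rightarrow> nat" where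
  "c_plus d n v = card {w \<in> pos_walks d n. visits d w = v}"

definition A_plus :: "nat \<Rightarrow> nat \<Rightarrow> complex poly" where
  "A_plus d n = (\<Sum>v\<le>n. monom (of_nat (c_plus d n v)) v)"

definition zeros_in :: "complex poly \<Rightarrow> complex set \<Rightarrow> nat" where
  "zeros_in p S = (\<Sum>z\<in>{z. poly p z = 0 \<and> z \<in> S}. order z p)"

definition closed_annulus :: "real \<Rightarrow> complex set" where
  "closed_annulus \<rho> = {a. 1 - \<rho> \<le> cmod a \<and> cmod a \<le> 1 / (1 - \<rho>)}"

definition open_annulus :: "real \<Rightarrow> complex set" where
  "open_annulus \<rho> = {a. 1 - \<rho> < cmod a \<and> cmod a < 1 / (1 - \<rho>)}"

definition nu :: "nat \<Rightarrow> nat \<Rightarrow> real \<Rightarrow> nat" where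
  "nu d n \<rho> = zeros_in (A_plus d n) (closed_annulus \<rho>)"

definition zeta :: "nat \<Rightarrow> real" where
  "zeta d = ln (mu d / mu (d - 1))"

end

theory Submission
  imports Defs "HOL-Complex_Analysis.Complex_Analysis"
    "HOL-Computational_Algebra.Fundamental_Theorem_Algebra"
begin

text \<open>
  On the unit circle the modulus of \<open>A_plus d n\<close> is at most the number \<open>P n\<close> of positive walks of
  length \<open>n\<close>. Its constant coefficient is at least \<open>P (n - 1)\<close>, and \<open>P n / P (n - 1)\<close> is bounded,
  so by Jensen's inequality only boundedly many zeros satisfy \<open>cmod a \<le> 1 - \<rho>\<close>. Its leading coefficient
  is at least the number of \<open>(d - 1)\<close>-dimensional walks, so the inequality at infinity leaves at most
  \<open>n * zeta d / - ln (1 - \<rho>) + o(n)\<close> zeros with \<open>cmod a \<ge> 1 / (1 - \<rho>)\<close>. All the other zeros are in the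
  open annulus, and \<open>\<rho> \<le> - ln (1 - \<rho>)\<close>.
\<close>

section \<open>Zeros away from the unit circle\<close>

text \<open>Maximum modulus principle on the closed unit disc: the constant coefficient is the value
  at the centre.\<close>

lemma cmod_coeff_0_le:
  fixes p :: "complex poly"
  assumes "\<And>z. cmod z = 1 \<Longrightarrow> cmod (poly p z) \<le> M"
  shows "cmod (coeff p 0) \<le> M"
proof -
  have "cmod (poly p 0) \<le> M"
  proof (rule maximum_modulus_frontier[of "poly p" "cball 0 1"])
    show "poly p holomorphic_on interior (cball 0 1)"
      by (intro holomorphic_intros)
    show "continuous_on (closure (cball 0 1)) (poly p)"
      by (intro continuous_intros)
  qed (use assms in auto)
  then show ?thesis by (simp add: poly_0_coeff_0)
qed

text \<open>Inversion in the unit circle: the leading coefficient of \<open>p\<close> is the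
  constant coefficient of \<open>reflect_poly p\<close>, and at \<open>z\<close> on the circle the
  latter has the modulus of \<open>p\<close> at \<open>inverse z\<close>.\<close>

lemma cmod_lead_coeff_le:
  fixes p :: "complex poly"
  assumes "\<And>z. cmod z = 1 \<Longrightarrow> cmod (poly p z) \<le> M"
  shows "cmod (lead_coeff p) \<le> M"
proof -
  have "cmod (coeff (reflect_poly p) 0) \<le> M"
  proof (rule cmod_coeff_0_le)
    fix z :: complex assume z: "cmod z = 1"
    then have "z \<noteq> 0" by auto
    then show "cmod (poly (reflect_poly p) z) \<le> M"
      using assms[of "inverse z"] z
      by (simp add: poly_reflect_poly_nz norm_mult norm_power norm_inverse)
  qed
  then show ?thesis by simp
qed

text \<open>On the circle 1 equals \<open>z * cnj z\<close>, so the left factor is \<open>z\<close>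
  times the conjugate of \<open>z - a\<close>.\<close>

lemma cmod_reflected_factor:
  assumes "cmod z = 1"
  shows "cmod (1 - cnj a * z) = cmod (z - a)"
proof -
  have "z * cnj z = 1"
    using assms by (simp add: complex_norm_square[symmetric])
  then have "1 - cnj a * z = z * cnj (z - a)"
    by (simp add: algebra_simps)
  then show ?thesis
    using assms by (simp add: norm_mult del: complex_cnj_diff)
qed

lemma cmod_poly_reflected_prod:
  assumes "cmod z = 1"
  shows "cmod (poly (\<Prod>a\<in>#B. [:1, - cnj a:]) z) = cmod (poly (\<Prod>a\<in>#B. [:- a, 1:]) z)"
proof (induction B)
  case (add a B)
  then show ?case
    using cmod_reflected_factor[OF assms, of a]
    by (simp add: norm_mult mult.commute del: mult_pCons_left)
qed simp

lemma zeros_in_eq_size: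
  assumes "p \<noteq> 0"
  shows "zeros_in p S = size (filter_mset (\<lambda>z. z \<in> S) (proots p))"
proof -
  have "zeros_in p S = (\<Sum>z\<in>{z. poly p z = 0 \<and> z \<in> S}. count (filter_mset (\<lambda>z. z \<in> S) (proots p)) z)"
    unfolding zeros_in_def using assms by (intro sum.cong) auto
  also have "{z. poly p z = 0 \<and> z \<in> S} = set_mset (filter_mset (\<lambda>z. z \<in> S) (proots p))"
    using assms by auto
  finally show ?thesis by (simp add: size_multiset_overloaded_eq)
qed

text \<open>Factor \<open>p\<close> over its multiset of roots and partition the roots by membership
  in \<open>S\<close>. \<open>B\<close> collects those in \<open>S\<close> with multiplicity;
  \<open>q\<close> absorbs the leading coefficient and all other factors.\<close>

lemma complex_poly_split_zeros:
  fixes p :: "complex poly"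
  assumes "p \<noteq> 0"
  obtains q B where "p = q * (\<Prod>a\<in>#B. [:- a, 1:])" "size B = zeros_in p S" "\<And>a. a \<in># B \<Longrightarrow> a \<in> S"
proof
  define B where "B = filter_mset (\<lambda>z. z \<in> S) (proots p)"
  define C where "C = filter_mset (\<lambda>z. z \<notin> S) (proots p)"
  have "p = smult (lead_coeff p) (\<Prod>a\<in>#proots p. [:- a, 1:])"
    by (rule complex_poly_decompose_multiset[symmetric])
  moreover have "proots p = C + B"
    unfolding B_def C_def using multiset_partition[of "proots p" "\<lambda>z. z \<in> S"] by simp
  ultimately show "p = smult (lead_coeff p) (\<Prod>a\<in>#C. [:- a, 1:]) * (\<Prod>a\<in>#B. [:- a, 1:])"
    by (metis image_mset_union prod_mset_Un mult_smult_left)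
  show "size B = zeros_in p S" using zeros_in_eq_size[OF assms] by (simp add: B_def)
  show "\<And>a. a \<in># B \<Longrightarrow> a \<in> S" by (auto simp: B_def)
qed

text \<open>Replacing each factor \<open>z - a\<close> by \<open>1 - cnj a * z\<close> keeps the modulus on the unit circle; this is
  Jensen's inequality for the small zeros, and its mirror image for the large ones.\<close>

lemma zeros_in_disc_bound:
  fixes p :: "complex poly"
  assumes "p \<noteq> 0" and M: "\<And>z. cmod z = 1 \<Longrightarrow> cmod (poly p z) \<le> M" and "0 \<le> r"
  shows "cmod (coeff p 0) \<le> M * r ^ zeros_in p {a. cmod a \<le> r}"
proof -
  obtain q B where p: "p = q * (\<Prod>a\<in>#B. [:- a, 1:])"
    and size: "size B = zeros_in p {a. cmod a \<le> r}" and B: "\<And>a. a \<in># B \<Longrightarrow> a \<in> {a. cmod a \<le> r}"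
    using complex_poly_split_zeros[OF assms(1)] by metis
  \<comment> \<open>After reflection the bound on the circle still holds, while each reflected
    factor equals 1 at 0; hence \<open>M\<close> bounds \<open>q\<close> itself at 0. The original
    factors then contribute at most \<open>r\<close> each.\<close>
  have "cmod (coeff (q * (\<Prod>a\<in>#B. [:1, - cnj a:])) 0) \<le> M"
    by (rule cmod_coeff_0_le) (use M in \<open>simp add: p norm_mult cmod_poly_reflected_prod\<close>)
  moreover have "poly (\<Prod>a\<in>#B. [:1, - cnj a:]) 0 = 1" by (induction B) (auto simp del: mult_pCons_left)
  ultimately have q: "cmod (poly q 0) \<le> M" by (simp add: poly_0_coeff_0[symmetric])
  have "cmod (poly (\<Prod>a\<in>#B. [:- a, 1:]) 0) \<le> r ^ size B"
    using B
  proof (induction B)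
    case (add a B)
    then have "cmod a * cmod (poly (\<Prod>a\<in>#B. [:- a, 1:]) 0) \<le> r * r ^ size B"
      using \<open>0 \<le> r\<close> by (intro mult_mono) auto
    then show ?case by (simp add: norm_mult del: mult_pCons_left)
  qed simp
  moreover have "0 \<le> M" using q norm_ge_zero order_trans by blast
  ultimately have "cmod (poly p 0) \<le> M * r ^ size B"
    unfolding p poly_mult norm_mult using q \<open>0 \<le> r\<close> by (intro mult_mono) auto
  then show ?thesis by (simp add: size poly_0_coeff_0)
qed

lemma zeros_outside_disc_bound:
  fixes p :: "complex poly"
  assumes "p \<noteq> 0" and M: "\<And>z. cmod z = 1 \<Longrightarrow> cmod (poly p z) \<le> M" and "0 < R"
  shows "cmod (lead_coeff p) * R ^ zeros_in p {a. R \<le> cmod a} \<le> M"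
proof -
  obtain q B where p: "p = q * (\<Prod>a\<in>#B. [:- a, 1:])"
    and size: "size B = zeros_in p {a. R \<le> cmod a}" and B: "\<And>a. a \<in># B \<Longrightarrow> a \<in> {a. R \<le> cmod a}"
    using complex_poly_split_zeros[OF assms(1)] by metis
  have "cmod (lead_coeff (q * (\<Prod>a\<in>#B. [:1, - cnj a:]))) \<le> M"
    by (rule cmod_lead_coeff_le) (use M in \<open>simp add: p norm_mult cmod_poly_reflected_prod\<close>)
  then have q: "cmod (lead_coeff q) * cmod (lead_coeff (\<Prod>a\<in>#B. [:1, - cnj a:])) \<le> M"
    by (simp only: lead_coeff_mult norm_mult)
  have "lead_coeff (\<Prod>a\<in>#B. [:- a, 1:]) = 1"
  proof (induction B)
    case (add a B)
    then show ?case by (simp add: lead_coeff_mult del: mult_pCons_left)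
  qed simp
  then have p_q: "lead_coeff p = lead_coeff q" by (simp only: p lead_coeff_mult mult_1_right)
  \<comment> \<open>A reflected factor has leading coefficient \<open>- cnj a\<close>, of modulus at
    least \<open>R\<close>. This uses \<open>a \<noteq> 0\<close>, which follows from
    \<open>0 < R\<close>; otherwise the factor would be the constant 1.\<close>
  have "R ^ size B \<le> cmod (lead_coeff (\<Prod>a\<in>#B. [:1, - cnj a:]))"
    using B
  proof (induction B)
    case (add a B)
    then have a: "a \<noteq> 0" using \<open>0 < R\<close> by force
    have "R * R ^ size B \<le> cmod a * cmod (lead_coeff (\<Prod>a\<in>#B. [:1, - cnj a:]))"
      using add \<open>0 < R\<close> by (intro mult_mono) auto
    then show ?case using a by (simp add: norm_mult lead_coeff_mult del: mult_pCons_left)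
  qed simp
  then have "cmod (lead_coeff q) * R ^ size B \<le> M"
    using q by (meson mult_left_mono norm_ge_zero order_trans)
  then show ?thesis by (simp only: size p_q)
qed

section \<open>Self-avoiding walks\<close>

text \<open>Fekete's lemma, with the infimum of the quotients as limit. Choose \<open>k\<close>
  whose quotient is within \<open>e / 2\<close> of the infimum and divide \<open>n\<close> by
  \<open>k\<close>: subadditivity handles the full blocks, and the remainder costs a bounded
  amount.\<close>

lemma subadditive_div_convergent:
  fixes u :: "nat \<Rightarrow> real"
  assumes sub: "\<And>m n. u (m + n) \<le> u m + u n" and nonneg: "\<And>n. 0 \<le> u n"
  obtains L where "(\<lambda>n. u n / real n) \<longlonglongrightarrow> L"
proof
  define L where "L = (INF n\<in>{1..}. u n / real n)"
  have bdd: "bdd_below ((\<lambda>n. u n / real n) ` {1..})"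
    by (rule bdd_belowI[of _ 0]) (auto simp: nonneg)
  have mult: "u (q * k + r) \<le> real q * u k + u r" for q k r
  proof (induction q)
    case (Suc q)
    have "u (Suc q * k + r) \<le> u k + u (q * k + r)"
      using sub[of k "q * k + r"] by (simp add: add.assoc)
    then show ?case using Suc by (simp add: algebra_simps)
  qed simp
  show "(\<lambda>n. u n / real n) \<longlonglongrightarrow> L"
  proof (rule LIMSEQ_I)
    fix e :: real assume "0 < e"
    then have "(INF n\<in>{1..}. u n / real n) < L + e / 2" by (simp add: L_def)
    then obtain k where k: "k \<ge> 1" "u k / real k < L + e / 2"
      using cINF_less_iff[OF _ bdd] by auto
    \<comment> \<open>\<open>C\<close> bounds \<open>u\<close> at every possible remainder modulo
      \<open>k\<close>; beyond \<open>N\<close> its share \<open>C / n\<close> is below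
      \<open>e / 2\<close>.\<close>
    define C where "C = Max (u ` {..<k})"
    obtain N :: nat where N: "2 * C / e < real N" using reals_Archimedean2 by blast
    have "norm (u n / real n - L) < e" if n: "n \<ge> max 1 N" for n
    proof -
      have n0: "real n > 0" "n \<ge> 1" using n by auto
      have "L \<le> u n / real n"
        unfolding L_def using n0 by (intro cINF_lower bdd) auto
      moreover have "u n / real n < L + e"
      proof -
        have "u n \<le> real (n div k) * u k + u (n mod k)"
          using mult[of "n div k" k "n mod k"] by simp
        also have "u (n mod k) \<le> C"
          unfolding C_def using k by (intro Max_ge) auto
        also have "real (n div k) * u k \<le> real n / real k * u k"
        proof (rule mult_right_mono)
          have "real (n div k * k) \<le> real n" by (intro of_nat_mono div_times_less_eq_dividend)
          then show "real (n div k) \<le> real n / real k" using k by (simp add: pos_le_divide_eq)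
        qed (rule nonneg)
        finally have "u n \<le> real n * (u k / real k) + C" by simp
        moreover have "real n * (u k / real k) < real n * (L + e / 2)"
          using k n0 by (intro mult_strict_left_mono) auto
        moreover have "C < real n * e / 2"
        proof -
          have "2 * C / e < real n" using N n by auto
          then show ?thesis using \<open>0 < e\<close> by (simp add: field_simps)
        qed
        ultimately have "u n < real n * (L + e)" by (simp add: algebra_simps)
        then show ?thesis using n0 by (simp add: field_simps)
      qed
      ultimately show ?thesis by simp
    qed
    then show "\<exists>no. \<forall>n\<ge>no. norm (u n / real n - L) < e" by blast
  qed
qed

section \<open>Cutting walks, and the existence of the growth constant\<close>

lemma adj_translate:
  assumes "adj d x y" "lattice_vertex d u"
  shows "adj d (\<lambda>i. x i + u i) (\<lambda>i. y i + u i)"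
  using assms by (auto simp: adj_def lattice_vertex_def)

lemma saw_nth_lattice_vertex:
  assumes "w \<in> saw d n" "i \<le> n"
  shows "lattice_vertex d (w ! i)"
proof (cases i)
  case 0
  then show ?thesis using assms by (auto simp: saw_def lattice_vertex_def origin_def)
next
  case (Suc j)
  then show ?thesis using assms by (auto simp: saw_def adj_def)
qed

text \<open>The vertex at time \<open>m\<close> belongs to both pieces: it ends the first and,
  translated to the origin, starts the second.\<close>

definition split_walk :: "nat \<Rightarrow> vertex list \<Rightarrow> vertex list \<times> vertex list" where
  "split_walk m w = (take (Suc m) w, map (\<lambda>x i. x i - (w ! m) i) (drop m w))"

lemma split_walk_in_saw:
  assumes w: "w \<in> saw d (m + n)"
  shows "split_walk m w \<in> saw d m \<times> saw d n"
proof -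
  have len: "length w = Suc (m + n)" and dist: "distinct w" and "w ! 0 = origin"
    and adj: "\<And>i. i < m + n \<Longrightarrow> adj d (w ! i) (w ! Suc i)"
    using w by (auto simp: saw_def)
  have "take (Suc m) w \<in> saw d m"
    using len dist adj \<open>w ! 0 = origin\<close> by (auto simp: saw_def)
  moreover have "map (\<lambda>x i. x i - (w ! m) i) (drop m w) \<in> saw d n"
  proof -
    have "lattice_vertex d (w ! m)" using saw_nth_lattice_vertex[OF w] by simp
    then have "lattice_vertex d (\<lambda>i. - (w ! m) i)" by (simp add: lattice_vertex_def)
    then have "adj d (\<lambda>j. (w ! (m + i)) j - (w ! m) j) (\<lambda>j. (w ! Suc (m + i)) j - (w ! m) j)"
      if "i < n" for i
      using adj_translate[OF adj[of "m + i"]] that by fastforce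
    moreover have "inj (\<lambda>(x :: vertex) i. x i - (w ! m) i)"
      by (auto simp: inj_def fun_eq_iff)
    ultimately show ?thesis
      using len dist by (auto simp: saw_def origin_def distinct_map intro: inj_on_subset)
  qed
  ultimately show ?thesis by (simp add: split_walk_def)
qed

text \<open>The first piece still records the vertex \<open>w ! m\<close>, so the translation of the
  second piece can be undone.\<close>

lemma inj_on_split_walk: "inj_on (split_walk m) (saw d (m + n))"
proof (rule inj_onI)
  fix v w assume v: "v \<in> saw d (m + n)" and w: "w \<in> saw d (m + n)"
    and eq: "split_walk m v = split_walk m w"
  have len: "length v = Suc (m + n)" "length w = Suc (m + n)" using v w by (auto simp: saw_def)
  have take: "take (Suc m) v = take (Suc m) w" using eq by (simp add: split_walk_def)
  then have m: "v ! m = w ! m" by (metis lessI nth_take)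
  have "inj (\<lambda>(x :: vertex) i. x i - (w ! m) i)"
    by (auto simp: inj_def fun_eq_iff)
  moreover have "map (\<lambda>x i. x i - (w ! m) i) (drop m v) = map (\<lambda>x i. x i - (w ! m) i) (drop m w)"
    using eq by (simp add: split_walk_def m)
  ultimately have "drop m v = drop m w" by (simp add: inj_map_eq_map)
  moreover have "take m v = take m w"
    using arg_cong[OF take, of "take m"] by simp
  ultimately show "v = w" by (metis append_take_drop_id)
qed

lemma finite_saw_1: "finite (saw d 1)"
proof -
  have "saw d 1 \<subseteq> (\<lambda>x. [origin, x]) ` {x. \<forall>i. (i \<in> {..<d} \<longrightarrow> x i \<in> {-1..1}) \<and> (i \<notin> {..<d} \<longrightarrow> x i = 0)}"
  proof
    fix w assume w: "w \<in> saw d 1"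
    define x where "x = w ! 1"
    have w_eq: "w = [origin, x]"
      using w by (auto simp: saw_def x_def length_Suc_conv)
    have adj: "lattice_vertex d x" "(\<Sum>i<d. \<bar>x i\<bar>) = 1"
      using w by (auto simp: saw_def w_eq adj_def origin_def)
    have "x i \<in> {-1..1}" if "i < d" for i
    proof -
      have "\<bar>x i\<bar> \<le> (\<Sum>i<d. \<bar>x i\<bar>)" using that by (intro member_le_sum) auto
      then show ?thesis using adj by auto
    qed
    then show "w \<in> (\<lambda>x. [origin, x]) ` {x. \<forall>i. (i \<in> {..<d} \<longrightarrow> x i \<in> {-1..1}) \<and> (i \<notin> {..<d} \<longrightarrow> x i = 0)}"
      using adj by (auto simp: w_eq lattice_vertex_def)
  qed
  then show ?thesis
    by (rule finite_subset) (intro finite_imageI finite_set_of_finite_funs; simp)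
qed

text \<open>Splitting off the last step embeds the longer walks into a product of two sets already
  known to be finite.\<close>

lemma finite_saw: "finite (saw d n)"
proof (induction n)
  case 0
  have "saw d 0 \<subseteq> {[origin]}" by (auto simp: saw_def length_Suc_conv)
  then show ?case by (rule finite_subset) simp
next
  case (Suc n)
  have "split_walk n ` saw d (n + 1) \<subseteq> saw d n \<times> saw d 1"
    using split_walk_in_saw by blast
  then show ?case
    using inj_on_split_walk[of n d 1] Suc finite_saw_1
    by (metis Suc_eq_plus1 finite_cartesian_product inj_on_finite)
qed

lemma card_saw_add_le: "card (saw d (m + n)) \<le> card (saw d m) * card (saw d n)"
proof -
  have "card (saw d (m + n)) \<le> card (saw d m \<times> saw d n)"
    using split_walk_in_saw inj_on_split_walk
    by (intro card_inj_on_le[of "split_walk m"] image_subsetI) (auto simp: finite_saw)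
  then show ?thesis by (simp add: card_cartesian_product)
qed

lemma saw_nonempty:
  assumes "d \<ge> 1"
  shows "saw d n \<noteq> {}"
proof -
  \<comment> \<open>The straight walk along coordinate 0, a direction that exists because
    \<open>d \<ge> 1\<close>.\<close>
  define v :: "nat \<Rightarrow> vertex" where "v k = (\<lambda>i. if i = 0 then int k else 0)" for k
  have "inj v" by (auto simp: inj_def v_def fun_eq_iff)
  moreover have "adj d (v k) (v (Suc k))" for k
  proof -
    have "(\<Sum>i<d. \<bar>v k i - v (Suc k) i\<bar>) = (\<Sum>i<d. if i = 0 then 1 else 0)"
      by (intro sum.cong) (auto simp: v_def)
    then show ?thesis using assms by (simp add: adj_def lattice_vertex_def v_def)
  qed
  moreover have "v 0 = origin" by (auto simp: v_def origin_def)
  ultimately have "map v [0..<Suc n] \<in> saw d n"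
    by (auto simp: saw_def distinct_map nth_append simp del: upt_Suc intro: inj_on_subset)
  then show ?thesis by blast
qed

lemma card_saw_pos: "d \<ge> 1 \<Longrightarrow> 0 < card (saw d n)"
  using saw_nonempty finite_saw by (simp add: card_gt_0_iff)

text \<open>\<open>mu\<close> is defined through \<open>lim\<close>, which is informative only once
  convergence is known. Fekete's lemma applied to the logarithms of the walk counts, subadditive by
  \<open>card_saw_add_le\<close>, supplies it.\<close>

lemma ln_card_saw_limit:
  assumes "d \<ge> 1"
  shows "(\<lambda>n. ln (real (card (saw d n))) / real n) \<longlonglongrightarrow> ln (mu d)" and "0 < mu d"
proof -
  define u where "u n = ln (real (card (saw d n)))" for n
  have pos: "1 \<le> real (card (saw d n))" for n
    using card_saw_pos[OF assms, of n] by simp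
  have "u (m + n) \<le> u m + u n" for m n
  proof -
    have "u (m + n) \<le> ln (real (card (saw d m) * card (saw d n)))"
      unfolding u_def using pos[of "m + n"] card_saw_add_le[of d m n]
      by (intro ln_mono of_nat_mono) auto
    also have "\<dots> = u m + u n"
      using pos[of m] pos[of n] by (simp add: u_def ln_mult)
    finally show ?thesis .
  qed
  moreover have "0 \<le> u n" for n using pos by (simp add: u_def)
  ultimately obtain L where L: "(\<lambda>n. u n / real n) \<longlonglongrightarrow> L"
    using subadditive_div_convergent[of u] by blast
  \<comment> \<open>This includes \<open>n = 0\<close>, where both quotients are 0 by the division
    convention and both sides are 1.\<close>
  have "real (card (saw d n)) powr (1 / real n) = exp (u n / real n)" for n
    using card_saw_pos[OF assms, of n] by (simp add: powr_def u_def)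
  moreover have "(\<lambda>n. exp (u n / real n)) \<longlonglongrightarrow> exp L" by (intro tendsto_exp L)
  ultimately have "mu d = exp L" by (simp add: mu_def limI)
  then show "(\<lambda>n. ln (real (card (saw d n))) / real n) \<longlonglongrightarrow> ln (mu d)" and "0 < mu d"
    using L by (auto simp: u_def)
qed

lemma saw_mono: "d \<le> e \<Longrightarrow> saw d n \<subseteq> saw e n"
proof -
  assume "d \<le> e"
  have "adj e x y" if "adj d x y" for x y
  proof -
    have "(\<Sum>i<e. \<bar>x i - y i\<bar>) = (\<Sum>i<d. \<bar>x i - y i\<bar>)"
      using that \<open>d \<le> e\<close> by (intro sum.mono_neutral_right) (auto simp: adj_def lattice_vertex_def)
    then show ?thesis using that \<open>d \<le> e\<close> by (auto simp: adj_def lattice_vertex_def)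
  qed
  then show ?thesis by (auto simp: saw_def)
qed

lemma zeta_eq:
  assumes "d \<ge> 2"
  shows "zeta d = ln (mu d) - ln (mu (d - 1))"
proof -
  have "0 < mu d" "0 < mu (d - 1)" using assms by (auto intro!: ln_card_saw_limit(2))
  then show ?thesis by (simp add: zeta_def ln_div)
qed

text \<open>The lattice of dimension \<open>d - 1\<close> is the hyperplane of last coordinate 0, so
  the walk counts compare for each length; then pass to the limit.\<close>

lemma zeta_nonneg:
  assumes "d \<ge> 2"
  shows "0 \<le> zeta d"
proof -
  have "ln (mu (d - 1)) \<le> ln (mu d)"
  proof (rule LIMSEQ_le)
    show "(\<lambda>n. ln (real (card (saw (d - 1) n))) / real n) \<longlonglongrightarrow> ln (mu (d - 1))"
      "(\<lambda>n. ln (real (card (saw d n))) / real n) \<longlonglongrightarrow> ln (mu d)"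
      using assms by (auto intro!: ln_card_saw_limit)
    have "ln (real (card (saw (d - 1) n))) / real n \<le> ln (real (card (saw d n))) / real n" for n
      using card_saw_pos[of "d - 1" n] assms
      by (intro divide_right_mono ln_mono of_nat_mono card_mono finite_saw saw_mono) auto
    then show "\<exists>N. \<forall>n\<ge>N. ln (real (card (saw (d - 1) n))) / real n \<le> ln (real (card (saw d n))) / real n"
      by blast
  qed
  then show ?thesis
    using zeta_eq assms by simp
qed

section \<open>Positive walks\<close>

lemma finite_pos_walks: "finite (pos_walks d n)"
  by (simp add: pos_walks_def finite_saw)

text \<open>A walk of the lower-dimensional lattice never leaves the surface, so each of its
  \<open>n\<close> vertices after the origin is a visit. This bounds the leading coefficient of
  \<open>A_plus d n\<close> from below.\<close>

lemma saw_subset_full_visits: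
  assumes "d \<ge> 1"
  shows "saw (d - 1) n \<subseteq> {w \<in> pos_walks d n. visits d w = n}"
proof
  fix w assume w: "w \<in> saw (d - 1) n"
  have len: "length w = Suc n" using w by (auto simp: saw_def)
  have zero: "(w ! i) (d - 1) = 0" if "i \<le> n" for i
    using saw_nth_lattice_vertex[OF w that] by (auto simp: lattice_vertex_def)
  have "{i. 1 \<le> i \<and> i < length w \<and> (w ! i) (d - 1) = 0} = {1..n}" using zero len by auto
  moreover have "x (d - 1) \<ge> 0" if "x \<in> set w" for x
    using that zero len by (auto simp: in_set_conv_nth less_Suc_eq_le)
  ultimately show "w \<in> {w \<in> pos_walks d n. visits d w = n}"
    using w saw_mono[of "d - 1" d n] by (auto simp: pos_walks_def visits_def)
qed

lemma card_saw_le_c_plus: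
  assumes "d \<ge> 1"
  shows "card (saw (d - 1) n) \<le> c_plus d n n"
  unfolding c_plus_def using finite_pos_walks
  by (intro card_mono saw_subset_full_visits assms) auto

lemma c_plus_full_pos:
  assumes "d \<ge> 2"
  shows "0 < c_plus d n n"
  using card_saw_pos[of "d - 1" n] card_saw_le_c_plus[of d n] assms by linarith

lemma visits_le: "w \<in> saw d n \<Longrightarrow> visits d w \<le> n"
proof -
  assume "w \<in> saw d n"
  then have "{i. 1 \<le> i \<and> i < length w \<and> (w ! i) (d - 1) = 0} \<subseteq> {1..n}" by (auto simp: saw_def)
  then have "visits d w \<le> card {1..n}" unfolding visits_def by (intro card_mono) auto
  then show ?thesis by simp
qed

lemma sum_c_plus: "(\<Sum>v\<le>n. c_plus d n v) = card (pos_walks d n)"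
proof -
  have "pos_walks d n = (\<Union>v\<le>n. {w \<in> pos_walks d n. visits d w = v})"
    using visits_le by (auto simp: pos_walks_def)
  moreover have "card (\<Union>v\<le>n. {w \<in> pos_walks d n. visits d w = v}) = (\<Sum>v\<le>n. c_plus d n v)"
    unfolding c_plus_def by (rule card_UN_disjoint) (auto simp: finite_pos_walks)
  ultimately show ?thesis by simp
qed

text \<open>Cut off the last step: an initial segment inherits positivity, while the final step is
  only required to be a one-step walk.\<close>

lemma card_pos_walks_Suc_le: "card (pos_walks d (Suc n)) \<le> card (pos_walks d n) * card (saw d 1)"
proof -
  have "card (pos_walks d (Suc n)) \<le> card (pos_walks d n \<times> saw d 1)"
  proof (rule card_inj_on_le[of "split_walk n"])
    show "inj_on (split_walk n) (pos_walks d (Suc n))"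
      using inj_on_split_walk[of n d 1] by (rule inj_on_subset) (auto simp: pos_walks_def)
    show "split_walk n ` pos_walks d (Suc n) \<subseteq> pos_walks d n \<times> saw d 1"
    proof (rule image_subsetI)
      fix w assume w: "w \<in> pos_walks d (Suc n)"
      then have "split_walk n w \<in> saw d n \<times> saw d 1"
        using split_walk_in_saw[of w d n 1] by (auto simp: pos_walks_def)
      moreover have "set (take (Suc n) w) \<subseteq> set w" by (rule set_take_subset)
      ultimately show "split_walk n w \<in> pos_walks d n \<times> saw d 1"
        using w by (auto simp: pos_walks_def split_walk_def)
    qed
    show "finite (pos_walks d n \<times> saw d 1)" by (simp add: finite_pos_walks finite_saw)
  qed
  then show ?thesis by (simp add: card_cartesian_product)
qed

text \<open>A walk starting with a step upwards and then staying above its first landing point never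
  returns to the surface.\<close>

lemma card_pos_walks_le_c_plus_0:
  assumes "d \<ge> 1"
  shows "card (pos_walks d n) \<le> c_plus d (Suc n) 0"
  unfolding c_plus_def
proof (rule card_inj_on_le)
  \<comment> \<open>\<open>e\<close> is the upward unit vector and \<open>f\<close> lifts a walk by
    one level, leaving the origin free as new starting point.\<close>
  define e :: vertex where "e = (\<lambda>i. if i = d - 1 then 1 else 0)"
  define f :: "vertex \<Rightarrow> vertex" where "f x = (\<lambda>i. x i + e i)" for x
  have inj: "inj f" by (auto simp: inj_def f_def fun_eq_iff)
  show "inj_on (\<lambda>w. origin # map f w) (pos_walks d n)"
    using inj by (auto simp: inj_on_def inj_map_eq_map)
  have e: "lattice_vertex d e" using assms by (auto simp: lattice_vertex_def e_def)
  have "(\<Sum>i<d. \<bar>origin i - f origin i\<bar>) = (\<Sum>i<d. if i = d - 1 then 1 else 0)"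
    by (intro sum.cong) (auto simp: f_def e_def origin_def)
  then have first: "adj d origin (f origin)"
    using e assms by (simp add: adj_def lattice_vertex_def origin_def f_def)
  show "(\<lambda>w. origin # map f w) ` pos_walks d n \<subseteq> {w \<in> pos_walks d (Suc n). visits d w = 0}"
  proof (rule image_subsetI)
    fix w assume w: "w \<in> pos_walks d n"
    then have saw: "length w = Suc n" "w ! 0 = origin" "distinct w"
      "\<And>i. i < n \<Longrightarrow> adj d (w ! i) (w ! Suc i)" by (auto simp: pos_walks_def saw_def)
    have pos: "f x (d - 1) > 0" if "x \<in> set w" for x
      using w that by (auto simp: pos_walks_def f_def e_def add_nonneg_pos)
    have "adj d ((origin # map f w) ! i) ((origin # map f w) ! Suc i)" if "i < Suc n" for i
    proof (cases i)
      case 0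
      then show ?thesis using first saw by simp
    next
      case (Suc j)
      then show ?thesis
        using adj_translate[OF saw(4)[of j] e] that saw(1) by (simp add: f_def)
    qed
    moreover have "origin \<notin> f ` set w"
    proof
      assume "origin \<in> f ` set w"
      then obtain x where "x \<in> set w" "f x = origin" by force
      then show False using pos[of x] by (simp add: origin_def)
    qed
    ultimately have "origin # map f w \<in> pos_walks d (Suc n)"
      using saw pos inj
      by (auto simp: pos_walks_def saw_def distinct_map origin_def
          intro: less_imp_le inj_on_subset)
    moreover have "((origin # map f w) ! i) (d - 1) \<noteq> 0" if "1 \<le> i" "i < Suc (Suc n)" for i
      using pos[of "w ! (i - 1)"] that saw(1) by (cases i) auto
    then have "visits d (origin # map f w) = 0"
      using saw(1) by (auto simp: visits_def)
    ultimately show "origin # map f w \<in> {w \<in> pos_walks d (Suc n). visits d w = 0}" by simp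
  qed
  show "finite {w \<in> pos_walks d (Suc n). visits d w = 0}" by (simp add: finite_pos_walks)
qed

section \<open>The partition function\<close>

lemma coeff_A_plus: "v \<le> n \<Longrightarrow> coeff (A_plus d n) v = of_nat (c_plus d n v)"
  by (simp add: A_plus_def coeff_sum)

lemma degree_A_plus:
  assumes "d \<ge> 2"
  shows "degree (A_plus d n) = n"
proof (rule antisym)
  show "degree (A_plus d n) \<le> n"
    unfolding A_plus_def by (intro degree_sum_le) (auto intro: order_trans[OF degree_monom_le])
  show "n \<le> degree (A_plus d n)"
    using c_plus_full_pos[OF assms, of n] by (intro le_degree) (simp add: coeff_A_plus)
qed

lemma A_plus_nonzero:
  assumes "d \<ge> 2"
  shows "A_plus d n \<noteq> 0"
proof -
  have "coeff (A_plus d n) n \<noteq> 0"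
    using c_plus_full_pos[OF assms, of n] by (simp add: coeff_A_plus)
  then show ?thesis by auto
qed

text \<open>The coefficients are nonnegative, so the triangle inequality bounds the modulus on the
  circle by the value at 1, which counts all positive walks.\<close>

lemma cmod_A_plus_le:
  assumes "cmod z = 1"
  shows "cmod (poly (A_plus d n) z) \<le> real (card (pos_walks d n))"
proof -
  have "cmod (poly (A_plus d n) z) = cmod (\<Sum>v\<le>n. of_nat (c_plus d n v) * z ^ v)"
    by (simp add: A_plus_def poly_sum poly_monom)
  also have "\<dots> \<le> (\<Sum>v\<le>n. real (c_plus d n v))"
    by (rule sum_norm_le) (simp add: norm_mult norm_power assms)
  also have "\<dots> = real (card (pos_walks d n))" by (simp add: sum_c_plus[symmetric])
  finally show ?thesis .
qed

lemma card_pos_walks_le: "card (pos_walks d n) \<le> card (saw d n)"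
  by (intro card_mono finite_saw) (auto simp: pos_walks_def)

lemma card_pos_walks_pos:
  assumes "d \<ge> 2"
  shows "0 < card (pos_walks d n)"
proof -
  have "pos_walks d n \<noteq> {}"
    using saw_nonempty[of "d - 1" n] saw_subset_full_visits[of d n] assms by auto
  then show ?thesis using finite_pos_walks by (simp add: card_gt_0_iff)
qed

text \<open>The constant coefficient and the maximum on the circle differ by at most the factor
  \<open>card (saw d 1)\<close>, so the bound is independent of \<open>n\<close>. Length
  \<open>Suc n\<close> leaves room for the initial upward step.\<close>

lemma A_plus_zeros_small:
  assumes "d \<ge> 2" "0 < r"
  shows "real (zeros_in (A_plus d (Suc n)) {a. cmod a \<le> r}) * - ln r \<le> ln (real (card (saw d 1)))"
proof -
  define k where "k = zeros_in (A_plus d (Suc n)) {a. cmod a \<le> r}"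
  define P where "P m = real (card (pos_walks d m))" for m
  define C where "C = real (card (saw d 1))"
  have pos: "0 < P n" "0 < C"
    using card_pos_walks_pos card_saw_pos[of d 1] assms by (auto simp: P_def C_def)
  have "P n \<le> real (c_plus d (Suc n) 0)"
    using card_pos_walks_le_c_plus_0[of d n] assms by (simp add: P_def)
  also have "\<dots> = cmod (coeff (A_plus d (Suc n)) 0)" by (simp add: coeff_A_plus)
  also have "\<dots> \<le> P (Suc n) * r ^ k"
    unfolding k_def P_def using assms
    by (intro zeros_in_disc_bound A_plus_nonzero cmod_A_plus_le) auto
  also have "\<dots> \<le> P n * C * r ^ k"
    using card_pos_walks_Suc_le[of d n] assms unfolding P_def C_def
    by (intro mult_right_mono) (auto simp flip: of_nat_mult)
  \<comment> \<open>The positive count \<open>P n\<close> cancels from both ends of the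
    chain.\<close>
  finally have "1 \<le> C * r ^ k" using pos by simp
  then have "0 \<le> ln (C * r ^ k)" by simp
  also have "\<dots> = ln C + real k * ln r" using pos assms by (simp add: ln_mult ln_realpow)
  finally show ?thesis by (simp add: k_def C_def)
qed

text \<open>Insert into \<open>zeros_outside_disc_bound\<close> the surface walks as lower bound for
  the leading coefficient and all self-avoiding walks as upper bound on the circle, then take
  logarithms.\<close>

lemma A_plus_zeros_large:
  assumes "d \<ge> 2" "0 < R"
  shows "real (zeros_in (A_plus d n) {a. R \<le> cmod a}) * ln R
    \<le> ln (real (card (saw d n))) - ln (real (card (saw (d - 1) n)))"
proof -
  define k where "k = zeros_in (A_plus d n) {a. R \<le> cmod a}"
  define b where "b = real (card (saw (d - 1) n))"
  have b: "0 < b" using card_saw_pos[of "d - 1" n] assms by (simp add: b_def)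
  have "b * R ^ k \<le> real (c_plus d n n) * R ^ k"
    unfolding b_def using card_saw_le_c_plus[of d n] assms by (intro mult_right_mono) auto
  also have "\<dots> = cmod (lead_coeff (A_plus d n)) * R ^ k"
    using assms by (simp add: degree_A_plus coeff_A_plus)
  also have "\<dots> \<le> real (card (pos_walks d n))"
    unfolding k_def using assms
    by (intro zeros_outside_disc_bound A_plus_nonzero cmod_A_plus_le) auto
  also have "\<dots> \<le> real (card (saw d n))" using card_pos_walks_le by simp
  finally have "ln (b * R ^ k) \<le> ln (real (card (saw d n)))"
    using b assms by (intro ln_mono) auto
  moreover have "ln (b * R ^ k) = ln b + real k * ln R"
    using b assms by (simp add: ln_mult ln_realpow)
  ultimately show ?thesis by (simp add: k_def b_def)
qed

section \<open>Counting the zeros in the annulus\<close>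

lemma zeros_in_mono:
  assumes "p \<noteq> 0" "S \<subseteq> T"
  shows "zeros_in p S \<le> zeros_in p T"
  unfolding zeros_in_eq_size[OF assms(1)]
  using assms(2) by (intro size_mset_mono filter_mset_mono_strong) auto

lemma zeros_in_le_degree: "(p :: complex poly) \<noteq> 0 \<Longrightarrow> zeros_in p S \<le> degree p"
  by (metis zeros_in_eq_size size_filter_mset_lesseq size_proots_complex)

lemma degree_le_zeros_in_Un:
  fixes p :: "complex poly"
  assumes "p \<noteq> 0" "S \<union> T \<union> U = UNIV"
  shows "degree p \<le> zeros_in p S + zeros_in p T + zeros_in p U"
proof -
  have "proots p \<subseteq># filter_mset (\<lambda>z. z \<in> S) (proots p) + filter_mset (\<lambda>z. z \<in> T) (proots p)
      + filter_mset (\<lambda>z. z \<in> U) (proots p)"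
    using assms(2) by (auto simp: subseteq_mset_def)
  then show ?thesis
    unfolding zeros_in_eq_size[OF assms(1)] size_proots_complex[symmetric]
    by (metis size_mset_mono size_union)
qed

text \<open>Discard from the \<open>n\<close> zeros those in the closed inner disc and those in the
  closed outer region. An explicit convergent minorant \<open>g\<close> then makes the lower limit
  immediate.\<close>

lemma open_annulus_zeros_fraction:
  assumes "d \<ge> 2" "0 < \<rho>" "\<rho> < 1"
  obtains g where "g \<longlonglongrightarrow> 1 - zeta d / - ln (1 - \<rho>)"
    and "\<And>n. n \<ge> 1 \<Longrightarrow> g n \<le> real (zeros_in (A_plus d n) (open_annulus \<rho>)) / real n"
proof
  define l where "l = - ln (1 - \<rho>)"
  have l: "l > 0" using assms by (simp add: l_def)
  define C where "C = ln (real (card (saw d 1)))"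
  define s where "s e n = ln (real (card (saw e n)))" for e n
  \<comment> \<open>The first term in the parentheses accounts for the inner zeros and vanishes in
    the limit; the difference accounts for the outer zeros and tends to
    \<open>zeta d\<close>.\<close>
  define g where "g n = 1 - (C / real n + (s d n / real n - s (d - 1) n / real n)) / l" for n
  have "(\<lambda>n. C / real n) \<longlonglongrightarrow> 0" by (rule lim_const_over_n)
  then have "g \<longlonglongrightarrow> 1 - (0 + (ln (mu d) - ln (mu (d - 1)))) / l"
    unfolding g_def s_def using assms l
    by (intro tendsto_intros ln_card_saw_limit) auto
  moreover have "zeta d = ln (mu d) - ln (mu (d - 1))"
    using zeta_eq assms by simp
  ultimately show "g \<longlonglongrightarrow> 1 - zeta d / - ln (1 - \<rho>)" by (simp add: l_def)
  fix n :: nat assume n: "n \<ge> 1"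
  define i where "i = zeros_in (A_plus d n) {a. cmod a \<le> 1 - \<rho>}"
  define k where "k = zeros_in (A_plus d n) {a. 1 / (1 - \<rho>) \<le> cmod a}"
  define z where "z = zeros_in (A_plus d n) (open_annulus \<rho>)"
  \<comment> \<open>The bound on small zeros concerns a successor length, hence \<open>n - 1\<close>
    and the restriction to \<open>n \<ge> 1\<close>.\<close>
  have "real i * l \<le> C"
    using A_plus_zeros_small[of d "1 - \<rho>" "n - 1"] assms n by (simp add: i_def l_def C_def)
  moreover have "ln (1 / (1 - \<rho>)) = l" using assms by (simp add: ln_div l_def)
  then have "real k * l \<le> s d n - s (d - 1) n"
    using A_plus_zeros_large[of d "1 / (1 - \<rho>)" n] assms by (simp add: k_def s_def)
  ultimately have "real i + real k \<le> (C + (s d n - s (d - 1) n)) / l"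
    using l by (simp add: pos_le_divide_eq algebra_simps)
  moreover have "open_annulus \<rho> \<union> {a. cmod a \<le> 1 - \<rho>} \<union> {a. 1 / (1 - \<rho>) \<le> cmod a} = UNIV"
    unfolding open_annulus_def by (auto simp only: Un_iff mem_Collect_eq not_le not_less)
  then have "n \<le> z + i + k"
    using degree_le_zeros_in_Un[OF A_plus_nonzero[OF assms(1)], of _ _ _ n]
    unfolding z_def i_def k_def degree_A_plus[OF assms(1)] by blast
  ultimately have "real n - (C + (s d n - s (d - 1) n)) / l \<le> real z" by linarith
  then have "(real n - (C + (s d n - s (d - 1) n)) / l) / real n \<le> real z / real n"
    by (rule divide_right_mono) simp
  moreover have "(real n - (C + (s d n - s (d - 1) n)) / l) / real n = g n"
    using n l by (simp add: g_def field_simps)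
  ultimately show "g n \<le> real (zeros_in (A_plus d n) (open_annulus \<rho>)) / real n"
    by (simp add: z_def)
qed

theorem theorem2p6:
  fixes d :: nat and \<rho> :: real
  assumes "d \<ge> 2" and "zeta d < \<rho>" and "\<rho> < 1"
  shows "0 < 1 - zeta d / \<rho>
    \<and> ereal (1 - zeta d / \<rho>) \<le> liminf (\<lambda>n. ereal (real (nu d n \<rho>) / real n))
    \<and> liminf (\<lambda>n. ereal (real (nu d n \<rho>) / real n))
        \<le> limsup (\<lambda>n. ereal (real (nu d n \<rho>) / real n))
    \<and> limsup (\<lambda>n. ereal (real (nu d n \<rho>) / real n)) \<le> 1
    \<and> 0 < liminf (\<lambda>n. ereal (real (zeros_in (A_plus d n) (open_annulus \<rho>))
                                / real (degree (A_plus d n))))"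
proof -
  have zeta: "0 \<le> zeta d" using zeta_nonneg assms by simp
  then have \<rho>: "0 < \<rho>" using assms by simp
  then have pos: "0 < 1 - zeta d / \<rho>" using assms by simp
  define z where "z n = zeros_in (A_plus d n) (open_annulus \<rho>)" for n
  obtain g where g: "g \<longlonglongrightarrow> 1 - zeta d / - ln (1 - \<rho>)"
    and g_le: "\<And>n. n \<ge> 1 \<Longrightarrow> g n \<le> real (z n) / real n"
    using open_annulus_zeros_fraction[OF assms(1) \<rho> assms(3)] unfolding z_def by blast
  \<comment> \<open>Together with \<open>zeta d \<ge> 0\<close>, this weakens the logarithmic bound
    to the stated one with denominator \<rho>.\<close>
  have "\<rho> \<le> - ln (1 - \<rho>)" using ln_le_minus_one[of "1 - \<rho>"] assms by simp
  then have "1 - zeta d / \<rho> \<le> 1 - zeta d / - ln (1 - \<rho>)"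
    using zeta \<rho> by (simp only: diff_left_mono divide_left_mono mult_pos_pos less_le_trans)
  moreover have "liminf (\<lambda>n. ereal (g n)) = ereal (1 - zeta d / - ln (1 - \<rho>))"
    using g by (intro lim_imp_Liminf tendsto_ereal) auto
  ultimately have "ereal (1 - zeta d / \<rho>) \<le> liminf (\<lambda>n. ereal (g n))" by simp
  also have "\<dots> \<le> liminf (\<lambda>n. ereal (real (z n) / real n))"
    using g_le by (intro Liminf_mono) (auto simp: eventually_sequentially)
  finally have open_bound: "ereal (1 - zeta d / \<rho>) \<le> liminf (\<lambda>n. ereal (real (z n) / real n))" .
  \<comment> \<open>The open annulus lies in the closed one, so \<open>open_bound\<close> yields
    both the bound for \<open>nu\<close> and the positive fraction.\<close>
  have "z n \<le> nu d n \<rho>" for n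
    unfolding z_def nu_def using assms(1)
    by (intro zeros_in_mono A_plus_nonzero) (auto simp: open_annulus_def closed_annulus_def)
  then have "liminf (\<lambda>n. ereal (real (z n) / real n)) \<le> liminf (\<lambda>n. ereal (real (nu d n \<rho>) / real n))"
    by (intro Liminf_mono always_eventually) (simp add: divide_right_mono)
  then have lower: "ereal (1 - zeta d / \<rho>) \<le> liminf (\<lambda>n. ereal (real (nu d n \<rho>) / real n))"
    using open_bound by (rule order_trans[rotated])
  have "nu d n \<rho> \<le> n" for n
    using zeros_in_le_degree[OF A_plus_nonzero[OF assms(1), of n]]
    by (simp add: nu_def degree_A_plus[OF assms(1)])
  \<comment> \<open>The quotient at \<open>n = 0\<close> is 0 by convention, so the bound by 1 holds
    for every \<open>n\<close>.\<close>
  then have "limsup (\<lambda>n. ereal (real (nu d n \<rho>) / real n)) \<le> 1"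
    by (intro Limsup_bounded always_eventually) (auto simp: divide_le_eq_1)
  moreover have "0 < liminf (\<lambda>n. ereal (real (z n) / real n))"
    using open_bound pos by (metis ereal_less(2) less_le_trans)
  ultimately show ?thesis
    using pos lower by (simp add: Liminf_le_Limsup z_def degree_A_plus[OF assms(1)])
qed

end
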